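(* Let $u,v$ be $\lambda_s$-terms. If $u\to_{\omega}v$, then $\phi(u)\triangleright^+\phi(v)$.
   Context: **Types.** There are two sets of base types $\mathcal{A} = \{a,b,\dots\}$ and $\mathcal{A}^{\perp} = \{a^{\perp},b^{\perp},\dots\}$. The $m$-types are generated by $A ::= a \mid a^{\perp} \mid A\wedge A \mid A\vee A$ ($a\in\mathcal{A}$). A type is either an $m$-type or the constant $\perp$. Negation of $m$-types: $(a)^{\perp}=a^{\perp}$, $(a^{\perp})^{\perp}=a$, $(A\wedge B)^{\perp}=A^{\perp}\vee B^{\perp}$, $(A\vee B)^{\perp}=A^{\perp}\wedge B^{\perp}$. Below $\Gamma$ is a set of declarations assigning $m$-types to variables and, in the rules, $A,B,C$ range over $m$-types. **System $\lambda^{Sym}_{Prop}$.** The $\lambda_s$-terms are the expressions (up to renaming of bound variables) typable by: - $\Gamma, x:A\vdash x:A$; - from $\Gamma\vdash u:A$ and $\Gamma\vdash v:B$ infer $\Gamma\vdash \langle u,v\rangle : A\wedge B$; - from $\Gamma\vdash t:A$ infer $\Gamma\vdash\sigma_1(t):A\vee B$; - from $\Gamma\vdash t:B$ infer $\Gamma\vdash\sigma_2(t):A\vee B$; - from $\Gamma,x:A\vdash t:\perp$ infer $\Gamma\vdash\lambda x.t:A^{\perp}$; - from $\Gamma\vdash u:A^{\perp}$ and $\Gamma\vdash v:A$ infer $\Gamma\vdash u\star v:\perp$. $Fv$ denotes the set of free variables, and substitution is capture-avoiding. One-step reduction $\to$ is application to a subterm (redex) of one of the rules: - $(\lambda x.u)\star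 v\to u[x:=v]$; - $v\star(\lambda x.u)\to u[x:=v]$; - $\lambda x.(u\star x)\to u$ if $x\notin Fv(u)$; - $\lambda x.(x\star u)\to u$ if $x\notin Fv(u)$; - $\langle u,v\rangle\star\sigma_1(w)\to u\star w$; - $\langle u,v\rangle\star\sigma_2(w)\to v\star w$; - $\sigma_1(w)\star\langle u,v\rangle\to w\star u$; - $\sigma_2(w)\star\langle u,v\rangle\to w\star v$; - (triv) $u[x:=v]\to v$ if $u$ and $v$ are terms of type $\perp$, $x$ occurs exactly once in $u$ and $u\neq x$ (here $x$ is a placeholder of type $\perp$; then $v=v_1\star v_2$ and $\lambda y.x$ is a subterm of $u$ for some $y$). Write $u\to_{\omega}v$ if $v$ is obtained by reducing in $u$ a redex (for any of these rules) which is not within the scope of a $\lambda$-abstraction. **System CCL.** The $c$-terms are the expressions built from variables and the constants $\mathbf{K},\mathbf{S},\mathbf{C},\mathbf{P},\mathbf{Q_1},\mathbf{Q_2}$ that are typable by: - $\Gamma,x:A\vdash x:A$; - $\Gamma\vdash\mathbf{K}:A^{\perp}\vee(B\vee A)$; - $\Gamma\vdash\mathbf{S}:(A\wedge(B\wedge C^{\perp}))\vee((A\wedge B^{\perp})\vee(A^{\perp}\vee C))$; - $\Gamma\vdash\mathbf{C}:(A\wedge B)\vee((A\wedge B^{\perp})\vee A^{\perp})$; - $\Gamma\vdash\mathbf{P}:A^{\perp}\vee(B^{\perp}\vee(A\wedge B))$; - $\Gamma\vdash\mathbf{Q_1}:A^{\perp}\vee(A\vee B)$; - $\Gamma\vdash\mathbf{Q_2}:B^{\perp}\vee(A\vee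 B)$; - from $\Gamma\vdash U:A^{\perp}\vee B$ and $\Gamma\vdash V:A$ infer $\Gamma\vdash(U\;V):B$; - from $\Gamma\vdash U:A^{\perp}$ and $\Gamma\vdash V:A$ infer $\Gamma\vdash U\star V:\perp$. Each axiom holds for all instances of $A,B,C$. $(U\;U_1\dots U_n)$ means $(\dots((U\;U_1)\;U_2)\dots U_n)$, and $\mathbf{I}=(\mathbf{S}\;\mathbf{K}\;\mathbf{K})$. $Var(T)$ is the set of variables of $T$. A pre-term is a $c$-term not containing $\star$. One-step reduction $\triangleright$ is application to a subterm of one of the rules: - $(\mathbf{K}\;U\;V)\triangleright U$; - $(\mathbf{S}\;U\;V\;W)\triangleright((U\;W)\;(V\;W))$; - $(\mathbf{C}\;U\;V)\star W\triangleright(U\;W)\star(V\;W)$; - $W\star(\mathbf{C}\;U\;V)\triangleright(U\;W)\star(V\;W)$; - $(\mathbf{C}\;(\mathbf{K}\;U)\;\mathbf{I})\triangleright U$; - $(\mathbf{C}\;\mathbf{I}\;(\mathbf{K}\;U))\triangleright U$; - $(\mathbf{P}\;U\;V)\star(\mathbf{Q_1}\;W)\triangleright U\star W$; - $(\mathbf{P}\;U\;V)\star(\mathbf{Q_2}\;W)\triangleright V\star W$; - $(\mathbf{Q_1}\;W)\star(\mathbf{P}\;U\;V)\triangleright W\star U$; - $(\mathbf{Q_2}\;W)\star(\mathbf{P}\;U\;V)\triangleright W\star V$; - (simp) $W[x:=(\mathbf{C}\;(\mathbf{K}\;U)\;(\mathbf{K}\;V))]\triangleright U\star V$ if $W$ is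 a $c$-term of type $\perp$ in which $x$ occurs. $\triangleright^+$ is the transitive closure of $\triangleright$. **Encoding $\phi$ of $\lambda_s$-terms into $c$-terms.** $\phi(x)=x$; $\phi(\lambda x.t)=l_x(\phi(t))$; $\phi(u\star v)=\phi(u)\star\phi(v)$; $\phi(\langle u,v\rangle)=(\mathbf{P}\;\phi(u)\;\phi(v))$; $\phi(\sigma_1(t))=(\mathbf{Q_1}\;\phi(t))$; $\phi(\sigma_2(t))=(\mathbf{Q_2}\;\phi(t))$, where - $l_x(x)=\mathbf{I}$; - $l_x(T)=(\mathbf{K}\;T)$ if $T$ is a pre-term and $x\notin Var(T)$; - $l_x((U\;V))=(\mathbf{S}\;l_x(U)\;l_x(V))$ if $x\in Var((U\;V))$; - $l_x(U\star V)=(\mathbf{C}\;l_x(U)\;l_x(V))$. *)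

theory Defs
  imports Main
begin

section \<open>Types\<close>

text \<open>Base types are named by natural numbers.\<close>

datatype mtype =
    Atom nat
  | NAtom nat
  | And mtype mtype  (infixr "\<^bold>\<and>" 75)
  | Or mtype mtype  (infixr "\<^bold>\<or>" 75)

datatype type = M mtype | Bot

fun neg :: "mtype \<Rightarrow> mtype" where
  "neg (Atom a) = NAtom a"
| "neg (NAtom a) = Atom a"
| "neg (A \<^bold>\<and> B) = neg A \<^bold>\<or> neg B"
| "neg (A \<^bold>\<or> B) = neg A \<^bold>\<and> neg B"


section \<open>The symmetric lambda calculus\<close>

text \<open>
  Expressions up to renaming of bound variables are represented with de Bruijn indices:
  below \<open>k\<close> abstractions, the index \<open>k + n\<close> denotes the free variable \<open>n\<close>.
\<close>

datatype lexp =
    LVar nat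
  | Lam lexp
  | LPair lexp lexp
  | Inj1 lexp
  | Inj2 lexp
  | LStar lexp lexp  (infix "\<star>\<^sub>l" 60)

fun lift :: "nat \<Rightarrow> lexp \<Rightarrow> lexp" where
  "lift k (LVar i) = (if i < k then LVar i else LVar (Suc i))"
| "lift k (Lam t) = Lam (lift (Suc k) t)"
| "lift k (LPair t u) = LPair (lift k t) (lift k u)"
| "lift k (Inj1 t) = Inj1 (lift k t)"
| "lift k (Inj2 t) = Inj2 (lift k t)"
| "lift k (t \<star>\<^sub>l u) = lift k t \<star>\<^sub>l lift k u"

text \<open>
  \<open>lsubst k s t\<close> substitutes \<open>s\<close> for the variable \<open>k\<close> of \<open>t\<close> and removes \<open>k\<close> from the
  scope, so that the variables above \<open>k\<close> move down by one.
\<close>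

fun lsubst :: "nat \<Rightarrow> lexp \<Rightarrow> lexp \<Rightarrow> lexp" where
  "lsubst k s (LVar i) = (if i < k then LVar i else if i = k then s else LVar (i - 1))"
| "lsubst k s (Lam t) = Lam (lsubst (Suc k) (lift 0 s) t)"
| "lsubst k s (LPair t u) = LPair (lsubst k s t) (lsubst k s u)"
| "lsubst k s (Inj1 t) = Inj1 (lsubst k s t)"
| "lsubst k s (Inj2 t) = Inj2 (lsubst k s t)"
| "lsubst k s (t \<star>\<^sub>l u) = lsubst k s t \<star>\<^sub>l lsubst k s u"

text \<open>Number of free occurrences of a variable.\<close>

fun occ :: "nat \<Rightarrow> lexp \<Rightarrow> nat" where
  "occ k (LVar i) = (if i = k then 1 else 0)"
| "occ k (Lam t) = occ (Suc k) t"
| "occ k (LPair t u) = occ k t + occ k u"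
| "occ k (Inj1 t) = occ k t"
| "occ k (Inj2 t) = occ k t"
| "occ k (t \<star>\<^sub>l u) = occ k t + occ k u"

text \<open>
  A context is a list whose \<open>n\<close>-th entry is the type of the variable \<open>n\<close>. Entries \<open>Bot\<close> are
  allowed here only to type the placeholder of the rule \<open>triv\<close>; the contexts of
  \<open>\<lambda>\<^sub>s\<close>-terms proper have the form \<open>map M \<Gamma>\<close>.
\<close>

inductive ltyping :: "type list \<Rightarrow> lexp \<Rightarrow> type \<Rightarrow> bool"  ("_ \<turnstile>\<^sub>l _ : _" [50, 50, 50] 50) where
  "i < length \<Gamma> \<Longrightarrow> \<Gamma> ! i = T \<Longrightarrow> \<Gamma> \<turnstile>\<^sub>l LVar i : T"
| "\<Gamma> \<turnstile>\<^sub>l u : M A \<Longrightarrow> \<Gamma> \<turnstile>\<^sub>l v : M B \<Longrightarrow> \<Gamma> \<turnstile>\<^sub>l LPair u v : M (A \<^bold>\<and> B)"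
| "\<Gamma> \<turnstile>\<^sub>l t : M A \<Longrightarrow> \<Gamma> \<turnstile>\<^sub>l Inj1 t : M (A \<^bold>\<or> B)"
| "\<Gamma> \<turnstile>\<^sub>l t : M B \<Longrightarrow> \<Gamma> \<turnstile>\<^sub>l Inj2 t : M (A \<^bold>\<or> B)"
| "M A # \<Gamma> \<turnstile>\<^sub>l t : Bot \<Longrightarrow> \<Gamma> \<turnstile>\<^sub>l Lam t : M (neg A)"
| "\<Gamma> \<turnstile>\<^sub>l u : M (neg A) \<Longrightarrow> \<Gamma> \<turnstile>\<^sub>l v : M A \<Longrightarrow> \<Gamma> \<turnstile>\<^sub>l u \<star>\<^sub>l v : Bot"

definition lterm :: "lexp \<Rightarrow> bool" where
  "lterm t \<longleftrightarrow> (\<exists>(\<Gamma> :: mtype list) T. map M \<Gamma> \<turnstile>\<^sub>l t : T)"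

text \<open>
  In the two \<open>eta\<close> rules, \<open>lift 0 u\<close> is \<open>u\<close> seen in the scope of a bound variable that does
  not occur in it. In \<open>triv\<close>, the placeholder is the variable \<open>0\<close> of \<open>u\<close>.
\<close>

inductive lcontract :: "lexp \<Rightarrow> lexp \<Rightarrow> bool" where
  beta: "lcontract (Lam u \<star>\<^sub>l v) (lsubst 0 v u)"
| beta_perp: "lcontract (v \<star>\<^sub>l Lam u) (lsubst 0 v u)"
| eta: "lcontract (Lam (lift 0 u \<star>\<^sub>l LVar 0)) u"
| eta_perp: "lcontract (Lam (LVar 0 \<star>\<^sub>l lift 0 u)) u"
| proj1: "lcontract (LPair u v \<star>\<^sub>l Inj1 w) (u \<star>\<^sub>l w)"
| proj2: "lcontract (LPair u v \<star>\<^sub>l Inj2 w) (v \<star>\<^sub>l w)"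
| proj1_perp: "lcontract (Inj1 w \<star>\<^sub>l LPair u v) (w \<star>\<^sub>l u)"
| proj2_perp: "lcontract (Inj2 w \<star>\<^sub>l LPair u v) (w \<star>\<^sub>l v)"
| triv: "Bot # map M \<Gamma> \<turnstile>\<^sub>l u : Bot \<Longrightarrow> map M \<Gamma> \<turnstile>\<^sub>l v : Bot \<Longrightarrow> occ 0 u = 1 \<Longrightarrow> u \<noteq> LVar 0
    \<Longrightarrow> lcontract (lsubst 0 v u) v"

text \<open>There is no congruence rule for \<open>Lam\<close>: redexes below an abstraction are not reduced.\<close>

inductive lred_omega :: "lexp \<Rightarrow> lexp \<Rightarrow> bool"  (infix "\<rightarrow>\<^sub>\<omega>" 50) where
  "lcontract u v \<Longrightarrow> u \<rightarrow>\<^sub>\<omega> v"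
| "u \<rightarrow>\<^sub>\<omega> u' \<Longrightarrow> LPair u v \<rightarrow>\<^sub>\<omega> LPair u' v"
| "v \<rightarrow>\<^sub>\<omega> v' \<Longrightarrow> LPair u v \<rightarrow>\<^sub>\<omega> LPair u v'"
| "t \<rightarrow>\<^sub>\<omega> t' \<Longrightarrow> Inj1 t \<rightarrow>\<^sub>\<omega> Inj1 t'"
| "t \<rightarrow>\<^sub>\<omega> t' \<Longrightarrow> Inj2 t \<rightarrow>\<^sub>\<omega> Inj2 t'"
| "u \<rightarrow>\<^sub>\<omega> u' \<Longrightarrow> u \<star>\<^sub>l v \<rightarrow>\<^sub>\<omega> u' \<star>\<^sub>l v"
| "v \<rightarrow>\<^sub>\<omega> v' \<Longrightarrow> u \<star>\<^sub>l v \<rightarrow>\<^sub>\<omega> u \<star>\<^sub>l v'"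


section \<open>Classical combinatory logic\<close>

datatype cexp =
    CVar nat
  | K | S | C | P | Q1 | Q2
  | App cexp cexp  (infixl "\<cdot>" 70)
  | CStar cexp cexp  (infix "\<star>\<^sub>c" 60)

fun cvars :: "cexp \<Rightarrow> nat set" where
  "cvars (CVar i) = {i}"
| "cvars (U \<cdot> V) = cvars U \<union> cvars V"
| "cvars (U \<star>\<^sub>c V) = cvars U \<union> cvars V"
| "cvars _ = {}"

text \<open>
  Simultaneous substitution, and substitution for one variable. There are no binders, and
  unlike \<open>lsubst\<close> the latter leaves all other variables unchanged.
\<close>

fun cinst :: "(nat \<Rightarrow> cexp) \<Rightarrow> cexp \<Rightarrow> cexp" where
  "cinst f (CVar i) = f i"
| "cinst f (U \<cdot> V) = cinst f U \<cdot> cinst f V"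
| "cinst f (U \<star>\<^sub>c V) = cinst f U \<star>\<^sub>c cinst f V"
| "cinst f T = T"

definition csubst :: "nat \<Rightarrow> cexp \<Rightarrow> cexp \<Rightarrow> cexp" where
  "csubst x T = cinst (CVar(x := T))"

inductive ctyping :: "mtype list \<Rightarrow> cexp \<Rightarrow> type \<Rightarrow> bool"  ("_ \<turnstile>\<^sub>c _ : _" [50, 50, 50] 50) where
  "i < length \<Gamma> \<Longrightarrow> \<Gamma> ! i = A \<Longrightarrow> \<Gamma> \<turnstile>\<^sub>c CVar i : M A"
| "\<Gamma> \<turnstile>\<^sub>c K : M (neg A \<^bold>\<or> (B \<^bold>\<or> A))"
| "\<Gamma> \<turnstile>\<^sub>c S : M ((A \<^bold>\<and> (B \<^bold>\<and> neg D)) \<^bold>\<or> ((A \<^bold>\<and> neg B) \<^bold>\<or> (neg A \<^bold>\<or> D)))"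
| "\<Gamma> \<turnstile>\<^sub>c C : M ((A \<^bold>\<and> B) \<^bold>\<or> ((A \<^bold>\<and> neg B) \<^bold>\<or> neg A))"
| "\<Gamma> \<turnstile>\<^sub>c P : M (neg A \<^bold>\<or> (neg B \<^bold>\<or> (A \<^bold>\<and> B)))"
| "\<Gamma> \<turnstile>\<^sub>c Q1 : M (neg A \<^bold>\<or> (A \<^bold>\<or> B))"
| "\<Gamma> \<turnstile>\<^sub>c Q2 : M (neg B \<^bold>\<or> (A \<^bold>\<or> B))"
| "\<Gamma> \<turnstile>\<^sub>c U : M (neg A \<^bold>\<or> B) \<Longrightarrow> \<Gamma> \<turnstile>\<^sub>c V : M A \<Longrightarrow> \<Gamma> \<turnstile>\<^sub>c U \<cdot> V : M B"
| "\<Gamma> \<turnstile>\<^sub>c U : M (neg A) \<Longrightarrow> \<Gamma> \<turnstile>\<^sub>c V : M A \<Longrightarrow> \<Gamma> \<turnstile>\<^sub>c U \<star>\<^sub>c V : Bot"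

definition cterm :: "cexp \<Rightarrow> bool" where
  "cterm U \<longleftrightarrow> (\<exists>\<Gamma> T. \<Gamma> \<turnstile>\<^sub>c U : T)"

abbreviation I :: cexp where
  "I \<equiv> S \<cdot> K \<cdot> K"

inductive ccontract :: "cexp \<Rightarrow> cexp \<Rightarrow> bool" where
  "ccontract (K \<cdot> U \<cdot> V) U"
| "ccontract (S \<cdot> U \<cdot> V \<cdot> W) ((U \<cdot> W) \<cdot> (V \<cdot> W))"
| "ccontract (C \<cdot> U \<cdot> V \<star>\<^sub>c W) (U \<cdot> W \<star>\<^sub>c V \<cdot> W)"
| "ccontract (W \<star>\<^sub>c C \<cdot> U \<cdot> V) (U \<cdot> W \<star>\<^sub>c V \<cdot> W)"
| "ccontract (C \<cdot> (K \<cdot> U) \<cdot> I) U"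
| "ccontract (C \<cdot> I \<cdot> (K \<cdot> U)) U"
| "ccontract (P \<cdot> U \<cdot> V \<star>\<^sub>c Q1 \<cdot> W) (U \<star>\<^sub>c W)"
| "ccontract (P \<cdot> U \<cdot> V \<star>\<^sub>c Q2 \<cdot> W) (V \<star>\<^sub>c W)"
| "ccontract (Q1 \<cdot> W \<star>\<^sub>c P \<cdot> U \<cdot> V) (W \<star>\<^sub>c U)"
| "ccontract (Q2 \<cdot> W \<star>\<^sub>c P \<cdot> U \<cdot> V) (W \<star>\<^sub>c V)"
| simp: "\<Gamma> \<turnstile>\<^sub>c W : Bot \<Longrightarrow> x \<in> cvars W
    \<Longrightarrow> ccontract (csubst x (C \<cdot> (K \<cdot> U) \<cdot> (K \<cdot> V)) W) (U \<star>\<^sub>c V)"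

inductive ccompat :: "cexp \<Rightarrow> cexp \<Rightarrow> bool" where
  "ccontract U V \<Longrightarrow> ccompat U V"
| "ccompat U U' \<Longrightarrow> ccompat (U \<cdot> V) (U' \<cdot> V)"
| "ccompat V V' \<Longrightarrow> ccompat (U \<cdot> V) (U \<cdot> V')"
| "ccompat U U' \<Longrightarrow> ccompat (U \<star>\<^sub>c V) (U' \<star>\<^sub>c V)"
| "ccompat V V' \<Longrightarrow> ccompat (U \<star>\<^sub>c V) (U \<star>\<^sub>c V')"

text \<open>Reduction relates typable expressions only, hence so do all steps of its transitive closure.\<close>

definition cred :: "cexp \<Rightarrow> cexp \<Rightarrow> bool"  (infix "\<triangleright>" 50) where
  "U \<triangleright> V \<longleftrightarrow> cterm U \<and> cterm V \<and> ccompat U V"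

abbreviation cred_trancl :: "cexp \<Rightarrow> cexp \<Rightarrow> bool"  (infix "\<triangleright>\<^sup>+" 50) where
  "U \<triangleright>\<^sup>+ V \<equiv> cred\<^sup>+\<^sup>+ U V"


section \<open>The encoding\<close>

text \<open>
  The value \<open>K \<cdot> T\<close> is intended for pre-terms \<open>T\<close>, that is, for typable \<open>T\<close> without \<open>\<star>\<^sub>c\<close>.
  In the last equation \<open>U \<cdot> V\<close> is one whenever it is typable, since an expression containing
  \<open>\<star>\<^sub>c\<close> can only have type \<open>Bot\<close>.
\<close>

fun abstr :: "nat \<Rightarrow> cexp \<Rightarrow> cexp" where
  "abstr x (CVar y) = (if y = x then I else K \<cdot> CVar y)"
| "abstr x K = K \<cdot> K"
| "abstr x S = K \<cdot> S"
| "abstr x C = K \<cdot> C"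
| "abstr x P = K \<cdot> P"
| "abstr x Q1 = K \<cdot> Q1"
| "abstr x Q2 = K \<cdot> Q2"
| "abstr x (U \<star>\<^sub>c V) = C \<cdot> abstr x U \<cdot> abstr x V"
| "abstr x (U \<cdot> V) = (if x \<in> cvars (U \<cdot> V) then S \<cdot> abstr x U \<cdot> abstr x V else K \<cdot> (U \<cdot> V))"

text \<open>
  The bound variable of \<open>Lam t\<close> is the variable \<open>0\<close> of \<open>t\<close>. It no longer occurs in
  \<open>abstr 0 (phi t)\<close>; the other variables are renumbered as seen from outside the abstraction.
\<close>

fun phi :: "lexp \<Rightarrow> cexp" where
  "phi (LVar i) = CVar i"
| "phi (Lam t) = cinst (\<lambda>i. CVar (i - 1)) (abstr 0 (phi t))"
| "phi (u \<star>\<^sub>l v) = phi u \<star>\<^sub>c phi v"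
| "phi (LPair u v) = P \<cdot> phi u \<cdot> phi v"
| "phi (Inj1 t) = Q1 \<cdot> phi t"
| "phi (Inj2 t) = Q2 \<cdot> phi t"

end

theory Submission
  imports Defs
begin

text \<open>
  The encoding turns a redex outside all abstractions into a redex of combinatory logic because
  bracket abstraction simulates substitution in both senses that matter. Applied to an argument,
  \<open>abstr x U\<close> reduces to \<open>U\<close> with the argument for \<open>x\<close> (\<open>abstr_App_reduces\<close>); and, as an operation
  on expressions, it commutes with substitution for the other variables (\<open>abstr_cinst\<close>), whence
  \<open>phi\<close> commutes with substitution (\<open>phi_lsubst\<close>). The second fact needs that what is substituted
  is not of the form \<open>U \<star>\<^sub>c V\<close>: abstracting a variable from such an expression yields
  \<open>C \<cdot> (K \<cdot> U) \<cdot> (K \<cdot> V)\<close>, and not \<open>K \<cdot> (U \<star>\<^sub>c V)\<close>. Arguments of a redex have an \<open>m\<close>-type, so this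
  is harmless for every rule but \<open>triv\<close>, where the substituted term has type \<open>Bot\<close>.

  For \<open>triv\<close>, the placeholder can only be the whole body of some abstraction. Hence substituting
  \<open>v\<close> for it amounts to substituting \<open>\<lambda>y. v\<close>, which has an \<open>m\<close>-type, for a variable standing for
  that abstraction (\<open>placeholder_is_body\<close>). Since \<open>v\<close> is some \<open>v\<^sub>1 \<star>\<^sub>l v\<^sub>2\<close>, the encoding of
  \<open>\<lambda>y. v\<close> is \<open>C \<cdot> (K \<cdot> phi v\<^sub>1) \<cdot> (K \<cdot> phi v\<^sub>2)\<close>, exactly the pattern of the rule \<open>simp\<close>.

  Typability of all intermediate expressions is a separate matter: \<open>phi\<close> preserves types, and
  combinatory reduction has the subject reduction property, so it suffices to find a sequence of
  steps of the untyped relation \<open>ccompat\<close>. This sequence then passes through arbitrary contexts.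
\<close>


section \<open>Typing in combinatory logic\<close>

lemma neg_neg [simp]: "neg (neg A) = A"
  by (induction A) auto

lemma neg_eq_iff [simp]: "neg A = neg B \<longleftrightarrow> A = B"
  by (metis neg_neg)

lemma neg_eq_And_iff: "neg X = A \<^bold>\<and> B \<longleftrightarrow> X = neg A \<^bold>\<or> neg B"
  by (metis neg.simps(3) neg_neg)

lemma ctyping_CStarI: "\<Gamma> \<turnstile>\<^sub>c U : M A \<Longrightarrow> \<Gamma> \<turnstile>\<^sub>c V : M (neg A) \<Longrightarrow> \<Gamma> \<turnstile>\<^sub>c U \<star>\<^sub>c V : Bot"
  by (metis ctyping.intros(9) neg_neg)

inductive_simps ctyping_CVar_iff: "\<Gamma> \<turnstile>\<^sub>c CVar i : T"
  and ctyping_K_iff: "\<Gamma> \<turnstile>\<^sub>c K : T"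
  and ctyping_S_iff: "\<Gamma> \<turnstile>\<^sub>c S : T"
  and ctyping_C_iff: "\<Gamma> \<turnstile>\<^sub>c C : T"
  and ctyping_P_iff: "\<Gamma> \<turnstile>\<^sub>c P : T"
  and ctyping_Q1_iff: "\<Gamma> \<turnstile>\<^sub>c Q1 : T"
  and ctyping_Q2_iff: "\<Gamma> \<turnstile>\<^sub>c Q2 : T"
  and ctyping_App_iff: "\<Gamma> \<turnstile>\<^sub>c U \<cdot> V : T"
  and ctyping_CStar_iff: "\<Gamma> \<turnstile>\<^sub>c U \<star>\<^sub>c V : T"

text \<open>
  With these equivalences, typability of a redex becomes a statement about its metavariables in
  which every constant has been accounted for.
\<close>

lemma ctyping_App_K_iff: "\<Gamma> \<turnstile>\<^sub>c K \<cdot> U : T \<longleftrightarrow> (\<exists>A B. T = M (B \<^bold>\<or> A) \<and> \<Gamma> \<turnstile>\<^sub>c U : M A)"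
  by (auto simp: ctyping_App_iff ctyping_K_iff)

lemma ctyping_App_S_iff:
  "\<Gamma> \<turnstile>\<^sub>c S \<cdot> U \<cdot> V : T \<longleftrightarrow>
    (\<exists>A B D. T = M (neg A \<^bold>\<or> D) \<and> \<Gamma> \<turnstile>\<^sub>c U : M (neg A \<^bold>\<or> (neg B \<^bold>\<or> D)) \<and> \<Gamma> \<turnstile>\<^sub>c V : M (neg A \<^bold>\<or> B))"
  by (fastforce simp: ctyping_App_iff ctyping_S_iff neg_eq_And_iff)

lemma ctyping_App_C_iff:
  "\<Gamma> \<turnstile>\<^sub>c C \<cdot> U \<cdot> V : T \<longleftrightarrow>
    (\<exists>A B. T = M (neg A) \<and> \<Gamma> \<turnstile>\<^sub>c U : M (neg A \<^bold>\<or> neg B) \<and> \<Gamma> \<turnstile>\<^sub>c V : M (neg A \<^bold>\<or> B))"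
  by (fastforce simp: ctyping_App_iff ctyping_C_iff neg_eq_And_iff)

lemma ctyping_App_P_iff:
  "\<Gamma> \<turnstile>\<^sub>c P \<cdot> U \<cdot> V : T \<longleftrightarrow> (\<exists>A B. T = M (A \<^bold>\<and> B) \<and> \<Gamma> \<turnstile>\<^sub>c U : M A \<and> \<Gamma> \<turnstile>\<^sub>c V : M B)"
  by (auto simp: ctyping_App_iff ctyping_P_iff)

lemma ctyping_App_Q1_iff: "\<Gamma> \<turnstile>\<^sub>c Q1 \<cdot> U : T \<longleftrightarrow> (\<exists>A B. T = M (A \<^bold>\<or> B) \<and> \<Gamma> \<turnstile>\<^sub>c U : M A)"
  by (auto simp: ctyping_App_iff ctyping_Q1_iff)

lemma ctyping_App_Q2_iff: "\<Gamma> \<turnstile>\<^sub>c Q2 \<cdot> U : T \<longleftrightarrow> (\<exists>A B. T = M (A \<^bold>\<or> B) \<and> \<Gamma> \<turnstile>\<^sub>c U : M B)"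
  by (auto simp: ctyping_App_iff ctyping_Q2_iff)

lemma ctyping_I_iff: "\<Gamma> \<turnstile>\<^sub>c I : T \<longleftrightarrow> (\<exists>A. T = M (neg A \<^bold>\<or> A))"
  by (auto simp: ctyping_App_S_iff ctyping_K_iff)

lemma ctyping_cvars: "\<Gamma> \<turnstile>\<^sub>c U : T \<Longrightarrow> i \<in> cvars U \<Longrightarrow> i < length \<Gamma>"
  by (induction rule: ctyping.induct) auto

lemma ctyping_cinst:
  assumes "\<Gamma> \<turnstile>\<^sub>c U : T"
    and "\<And>i. i \<in> cvars U \<Longrightarrow> \<Delta> \<turnstile>\<^sub>c f i : M (\<Gamma> ! i)"
  shows "\<Delta> \<turnstile>\<^sub>c cinst f U : T"
  using assms by (induction rule: ctyping.induct) (auto intro: ctyping.intros)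

lemma ctyping_cinst_argument:
  "\<Gamma> \<turnstile>\<^sub>c cinst f U : T \<Longrightarrow> x \<in> cvars U \<Longrightarrow> \<exists>T'. \<Gamma> \<turnstile>\<^sub>c f x : T'"
  by (induction U arbitrary: T) (auto simp: ctyping_App_iff ctyping_CStar_iff)

lemma ctyping_BotE:
  assumes "\<Gamma> \<turnstile>\<^sub>c U : Bot"
  obtains U1 U2 where "U = U1 \<star>\<^sub>c U2"
  using assms by cases auto


section \<open>Subject reduction\<close>

text \<open>
  In the rule \<open>simp\<close>, the typing of \<open>W\<close> says nothing about \<open>U\<close> and \<open>V\<close>. They are typable because
  \<open>x\<close> occurs in \<open>W\<close>, so that a typing of the redex contains one of \<open>C \<cdot> (K \<cdot> U) \<cdot> (K \<cdot> V)\<close>.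
\<close>

lemma ccontract_preserves_type:
  assumes "ccontract U V" and "\<Gamma> \<turnstile>\<^sub>c U : T"
  shows "\<Gamma> \<turnstile>\<^sub>c V : T"
proof -
  \<comment> \<open>The component of the pair yields a type whose negation is that of the injected term, so the
    typing rule for \<open>\<star>\<^sub>c\<close>, with the negation on the left, applies only up to \<open>neg (neg A) = A\<close>.\<close>
  have P_Q1: "\<Gamma> \<turnstile>\<^sub>c U \<star>\<^sub>c W : T" if PQ: "\<Gamma> \<turnstile>\<^sub>c P \<cdot> U \<cdot> V \<star>\<^sub>c Q1 \<cdot> W : T" for U V W
  proof -
    from PQ obtain A where "T = Bot" "\<Gamma> \<turnstile>\<^sub>c U : M A" "\<Gamma> \<turnstile>\<^sub>c W : M (neg A)"
      by (auto simp: ctyping_CStar_iff ctyping_App_P_iff ctyping_App_Q1_iff neg_eq_And_iff)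
    then show ?thesis
      by (simp add: ctyping_CStarI)
  qed
  have P_Q2: "\<Gamma> \<turnstile>\<^sub>c V \<star>\<^sub>c W : T" if PQ: "\<Gamma> \<turnstile>\<^sub>c P \<cdot> U \<cdot> V \<star>\<^sub>c Q2 \<cdot> W : T" for U V W
  proof -
    from PQ obtain A where "T = Bot" "\<Gamma> \<turnstile>\<^sub>c V : M A" "\<Gamma> \<turnstile>\<^sub>c W : M (neg A)"
      by (auto simp: ctyping_CStar_iff ctyping_App_P_iff ctyping_App_Q2_iff neg_eq_And_iff)
    then show ?thesis
      by (simp add: ctyping_CStarI)
  qed
  from assms show ?thesis
  proof (induction rule: ccontract.induct)
    case (simp \<Delta> W x U V)
    from simp.hyps(1) obtain W1 W2 where W: "W = W1 \<star>\<^sub>c W2"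
      by (rule ctyping_BotE)
    from simp.prems have "T = Bot"
      by (auto simp: W csubst_def ctyping_CStar_iff)
    moreover from simp have "\<exists>T'. \<Gamma> \<turnstile>\<^sub>c C \<cdot> (K \<cdot> U) \<cdot> (K \<cdot> V) : T'"
      unfolding csubst_def by (auto dest!: ctyping_cinst_argument)
    ultimately show ?case
      by (auto simp: ctyping_App_C_iff ctyping_App_K_iff ctyping_CStar_iff)
  qed (erule P_Q1 P_Q2
    | force simp: ctyping_CStar_iff ctyping_App_P_iff ctyping_App_Q1_iff ctyping_App_Q2_iff
    | fastforce simp: ctyping_App_iff ctyping_CStar_iff ctyping_K_iff ctyping_S_iff ctyping_C_iff
        neg_eq_And_iff)+
qed

lemma ccompat_preserves_type: "ccompat U V \<Longrightarrow> \<Gamma> \<turnstile>\<^sub>c U : T \<Longrightarrow> \<Gamma> \<turnstile>\<^sub>c V : T"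
  by (induction arbitrary: T rule: ccompat.induct)
    (blast intro: ccontract_preserves_type, (fastforce simp: ctyping_App_iff ctyping_CStar_iff)+)

lemma ccompat_tranclp_imp_cred_tranclp:
  assumes "ccompat\<^sup>+\<^sup>+ U V" and "\<Gamma> \<turnstile>\<^sub>c U : T"
  shows "U \<triangleright>\<^sup>+ V"
proof -
  from assms have "U \<triangleright>\<^sup>+ V \<and> \<Gamma> \<turnstile>\<^sub>c V : T"
  proof (induction rule: tranclp_induct)
    case (base V)
    then have "\<Gamma> \<turnstile>\<^sub>c V : T"
      using ccompat_preserves_type by blast
    with base have "U \<triangleright> V"
      unfolding cred_def cterm_def by blast
    with \<open>\<Gamma> \<turnstile>\<^sub>c V : T\<close> show ?case
      by blast
  next
    case (step V W)
    then have "\<Gamma> \<turnstile>\<^sub>c V : T" "\<Gamma> \<turnstile>\<^sub>c W : T" "U \<triangleright>\<^sup>+ V"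
      using ccompat_preserves_type by blast+
    moreover from this step.hyps have "V \<triangleright> W"
      unfolding cred_def cterm_def by blast
    ultimately show ?case
      by (blast intro: tranclp.trancl_into_trancl)
  qed
  then show ?thesis ..
qed


section \<open>Bracket abstraction\<close>

lemma cvars_cinst: "cvars (cinst f U) = (\<Union>i\<in>cvars U. cvars (f i))"
  by (induction U) auto

lemma cinst_cong: "(\<And>i. i \<in> cvars U \<Longrightarrow> f i = g i) \<Longrightarrow> cinst f U = cinst g U"
  by (induction U) auto

lemma cinst_cinst: "cinst f (cinst g U) = cinst (\<lambda>i. cinst f (g i)) U"
  by (induction U) auto

lemma cinst_CVar [simp]: "cinst CVar U = U"
  by (induction U) auto

lemma cvars_abstr: "cvars (abstr x U) = cvars U - {x}"
  by (induction U) auto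

lemma abstr_fresh:
  "x \<notin> cvars U \<Longrightarrow> (\<And>U1 U2. U \<noteq> U1 \<star>\<^sub>c U2) \<Longrightarrow> abstr x U = K \<cdot> U"
  by (cases U) auto

lemma abstr_cinst:
  assumes "f x = CVar x"
    and "\<And>y. y \<noteq> x \<Longrightarrow> x \<notin> cvars (f y)"
    and "\<And>y U1 U2. y \<noteq> x \<Longrightarrow> f y \<noteq> U1 \<star>\<^sub>c U2"
  shows "abstr x (cinst f U) = cinst f (abstr x U)"
proof -
  \<comment> \<open>\<open>f\<close> neither removes nor creates occurrences of \<open>x\<close>, so \<open>abstr\<close> takes the same branch on both sides\<close>
  have "x \<in> cvars (cinst f U) \<longleftrightarrow> x \<in> cvars U" for U
    using assms(1,2) by (fastforce simp: cvars_cinst intro: bexI [of _ x])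
  then show ?thesis
    using assms by (induction U) (auto simp: abstr_fresh)
qed

lemma ctyping_abstr:
  assumes "\<Gamma> \<turnstile>\<^sub>c U : M B" and "\<Gamma> \<turnstile>\<^sub>c CVar x : M A"
  shows "\<Gamma> \<turnstile>\<^sub>c abstr x U : M (neg A \<^bold>\<or> B)"
  using assms
proof (induction U arbitrary: B)
  case (App U V)
  then obtain D where "\<Gamma> \<turnstile>\<^sub>c U : M (neg D \<^bold>\<or> B)" "\<Gamma> \<turnstile>\<^sub>c V : M D"
    by (auto simp: ctyping_App_iff)
  with App show ?case
    by (auto simp: ctyping_App_S_iff ctyping_App_K_iff)
next
  case (CStar U V)
  then show ?case
    by (simp add: ctyping_CStar_iff)
qed (auto simp: ctyping_App_K_iff ctyping_I_iff ctyping_CVar_iff)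

lemma ccompat_rtranclp_App:
  assumes "ccompat\<^sup>*\<^sup>* U U'" and "ccompat\<^sup>*\<^sup>* V V'"
  shows "ccompat\<^sup>*\<^sup>* (U \<cdot> V) (U' \<cdot> V')"
proof -
  from assms(1) have "ccompat\<^sup>*\<^sup>* (U \<cdot> V) (U' \<cdot> V)"
    by induction (auto intro: ccompat.intros rtranclp.rtrancl_into_rtrancl)
  also from assms(2) have "ccompat\<^sup>*\<^sup>* (U' \<cdot> V) (U' \<cdot> V')"
    by induction (auto intro: ccompat.intros rtranclp.rtrancl_into_rtrancl)
  finally show ?thesis .
qed

lemma ccompat_rtranclp_CStar:
  assumes "ccompat\<^sup>*\<^sup>* U U'" and "ccompat\<^sup>*\<^sup>* V V'"
  shows "ccompat\<^sup>*\<^sup>* (U \<star>\<^sub>c V) (U' \<star>\<^sub>c V')"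
proof -
  from assms(1) have "ccompat\<^sup>*\<^sup>* (U \<star>\<^sub>c V) (U' \<star>\<^sub>c V)"
    by induction (auto intro: ccompat.intros rtranclp.rtrancl_into_rtrancl)
  also from assms(2) have "ccompat\<^sup>*\<^sup>* (U' \<star>\<^sub>c V) (U' \<star>\<^sub>c V')"
    by induction (auto intro: ccompat.intros rtranclp.rtrancl_into_rtrancl)
  finally show ?thesis .
qed

text \<open>
  The typing hypothesis confines \<open>U\<close> to pre-terms: the abstraction of some \<open>U \<star>\<^sub>c V\<close> has the
  form \<open>C \<cdot> U' \<cdot> V'\<close>, which has to meet its argument through \<open>\<star>\<^sub>c\<close> to form a redex with it. The substitution \<open>f\<close> of the other
  variables is there because \<open>phi\<close> renumbers them after each abstraction.
\<close>

lemma abstr_App_reduces: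
  assumes "\<Gamma> \<turnstile>\<^sub>c U : M B"
  shows "ccompat\<^sup>*\<^sup>* (cinst f (abstr x U) \<cdot> W) (cinst (f(x := W)) U)"
  using assms
proof (induction U arbitrary: B)
  case (CVar y)
  have "ccompat (I \<cdot> W) (K \<cdot> W \<cdot> (K \<cdot> W))"
    by (intro ccompat.intros(1) ccontract.intros)
  moreover have K: "ccompat (K \<cdot> U \<cdot> V) U" for U V
    by (intro ccompat.intros(1) ccontract.intros)
  ultimately have "ccompat\<^sup>*\<^sup>* (I \<cdot> W) W"
    by (meson converse_rtranclp_into_rtranclp r_into_rtranclp)
  then show ?case
    by (auto intro: K)
next
  case (App U V)
  show ?case
  proof (cases "x \<in> cvars (U \<cdot> V)")
    case True
    have "ccompat (cinst f (abstr x (U \<cdot> V)) \<cdot> W)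
        ((cinst f (abstr x U) \<cdot> W) \<cdot> (cinst f (abstr x V) \<cdot> W))"
      using True by (auto intro!: ccompat.intros(1) ccontract.intros)
    moreover have "ccompat\<^sup>*\<^sup>* ((cinst f (abstr x U) \<cdot> W) \<cdot> (cinst f (abstr x V) \<cdot> W))
        (cinst (f(x := W)) (U \<cdot> V))"
      using App unfolding ctyping_App_iff cinst.simps by (blast intro: ccompat_rtranclp_App)
    ultimately show ?thesis
      by (rule converse_rtranclp_into_rtranclp)
  next
    case False
    then have "cinst (f(x := W)) (U \<cdot> V) = cinst f (U \<cdot> V)"
      by (intro cinst_cong) auto
    moreover have "ccompat (cinst f (abstr x (U \<cdot> V)) \<cdot> W) (cinst f (U \<cdot> V))"
      using False by (auto intro!: ccompat.intros(1) ccontract.intros)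
    ultimately show ?thesis
      by (simp only: r_into_rtranclp)
  qed
next
  case (CStar U V)
  then show ?case
    by (simp add: ctyping_CStar_iff)
qed (auto intro!: r_into_rtranclp ccompat.intros(1) ccontract.intros)


section \<open>The encoding\<close>

inductive_simps ltyping_LVar_iff: "\<Gamma> \<turnstile>\<^sub>l LVar i : T"
  and ltyping_Lam_iff: "\<Gamma> \<turnstile>\<^sub>l Lam t : T"
  and ltyping_LPair_iff: "\<Gamma> \<turnstile>\<^sub>l LPair u v : T"
  and ltyping_Inj1_iff: "\<Gamma> \<turnstile>\<^sub>l Inj1 t : T"
  and ltyping_Inj2_iff: "\<Gamma> \<turnstile>\<^sub>l Inj2 t : T"
  and ltyping_LStar_iff: "\<Gamma> \<turnstile>\<^sub>l u \<star>\<^sub>l v : T"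

lemma ltyping_BotE:
  assumes "map M \<Gamma> \<turnstile>\<^sub>l u : Bot"
  obtains u1 u2 where "u = u1 \<star>\<^sub>l u2"
  using assms by cases auto

lemma phi_Lam_LStar:
  "phi (Lam (u \<star>\<^sub>l v)) = C \<cdot> cinst (\<lambda>i. CVar (i - 1)) (abstr 0 (phi u))
      \<cdot> cinst (\<lambda>i. CVar (i - 1)) (abstr 0 (phi v))"
  by simp

lemma phi_not_CStar:
  assumes "\<Gamma> \<turnstile>\<^sub>l u : M A"
  shows "phi u \<noteq> U \<star>\<^sub>c V"
proof -
  have "cinst f (abstr x W) \<noteq> U \<star>\<^sub>c V" for f x W
    by (cases W) auto
  with assms show ?thesis
    by (cases u) (auto simp: ltyping_LStar_iff)
qed

lemma ctyping_phi: "map M \<Gamma> \<turnstile>\<^sub>l t : T \<Longrightarrow> \<Gamma> \<turnstile>\<^sub>c phi t : T"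
proof (induction "map M \<Gamma>" t T arbitrary: \<Gamma> rule: ltyping.induct)
  case (5 A t)
  then have "A # \<Gamma> \<turnstile>\<^sub>c phi t : Bot" by simp
  then obtain U V B where t: "phi t = U \<star>\<^sub>c V"
    and UV: "A # \<Gamma> \<turnstile>\<^sub>c U : M (neg B)" "A # \<Gamma> \<turnstile>\<^sub>c V : M B"
    by (metis ctyping_BotE ctyping_CStar_iff)
  have "A # \<Gamma> \<turnstile>\<^sub>c CVar 0 : M A"
    by (simp add: ctyping_CVar_iff)
  with UV have typed: "A # \<Gamma> \<turnstile>\<^sub>c abstr 0 (phi t) : M (neg A)"
    using ctyping_abstr by (fastforce simp: t ctyping_App_C_iff)
  show ?case
    unfolding phi.simps
  proof (rule ctyping_cinst [OF typed])
    fix i assume i: "i \<in> cvars (abstr 0 (phi t))"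
    with typed have "i < Suc (length \<Gamma>)"
      using ctyping_cvars by fastforce
    moreover from i have "i \<noteq> 0"
      by (simp add: cvars_abstr)
    ultimately show "\<Gamma> \<turnstile>\<^sub>c CVar (i - 1) : M ((A # \<Gamma>) ! i)"
      by (auto simp: ctyping_CVar_iff)
  qed
qed (auto simp: ctyping_CVar_iff ctyping_App_P_iff ctyping_App_Q1_iff ctyping_App_Q2_iff
      ctyping_CStar_iff)

lemma cvars_phi: "i \<in> cvars (phi t) \<longleftrightarrow> occ i t \<noteq> 0"
proof (induction t arbitrary: i)
  case (Lam t)
  have "i \<in> cvars (phi (Lam t)) \<longleftrightarrow> Suc i \<in> cvars (phi t)"
    by (auto simp: cvars_cinst cvars_abstr intro: bexI [of _ "Suc i"])
      (metis Suc_pred neq0_conv)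
  with Lam show ?case
    by simp
qed auto

lemma phi_lift: "phi (lift k t) = cinst (\<lambda>i. CVar (if i < k then i else Suc i)) (phi t)"
proof (induction t arbitrary: k)
  case (Lam t)
  have "phi (lift k (Lam t)) = cinst (\<lambda>i. CVar (i - 1))
      (cinst (\<lambda>i. CVar (if i < Suc k then i else Suc i)) (abstr 0 (phi t)))"
    using Lam by (simp add: abstr_cinst)
  then show ?case
    by (auto simp: cinst_cinst cvars_abstr intro!: cinst_cong)
qed auto

text \<open>
  The hypothesis on \<open>s\<close> fails for \<open>s\<close> of type \<open>Bot\<close>, and then the equation can fail, too:
  replacing \<open>x\<close> by \<open>u \<star>\<^sub>l v\<close> in \<open>\<lambda>y. x\<close> turns \<open>K \<cdot> x\<close> into \<open>C \<cdot> (K \<cdot> phi u) \<cdot> (K \<cdot> phi v)\<close>.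
\<close>

lemma phi_lsubst:
  assumes "\<And>U V. phi s \<noteq> U \<star>\<^sub>c V"
  shows "phi (lsubst k s t) =
    cinst (\<lambda>i. if i < k then CVar i else if i = k then phi s else CVar (i - 1)) (phi t)"
  using assms
proof (induction t arbitrary: k s)
  case (Lam t)
  let ?\<sigma> = "\<lambda>k s i. if i < k then CVar i else if i = k then phi s else CVar (i - 1)"
  have s: "phi (lift 0 s) = cinst (\<lambda>i. CVar (Suc i)) (phi s)"
    by (simp add: phi_lift)
  with Lam.prems have s_not_CStar: "phi (lift 0 s) \<noteq> U \<star>\<^sub>c V" for U V
    by (cases "phi s") auto
  with Lam.IH have "phi (lsubst k s (Lam t)) =
      cinst (\<lambda>i. CVar (i - 1)) (abstr 0 (cinst (?\<sigma> (Suc k) (lift 0 s)) (phi t)))"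
    by simp
  also have "\<dots> = cinst (\<lambda>i. CVar (i - 1)) (cinst (?\<sigma> (Suc k) (lift 0 s)) (abstr 0 (phi t)))"
    using s_not_CStar by (subst abstr_cinst) (auto simp: s cvars_cinst)
  also have "\<dots> = cinst (?\<sigma> k s) (phi (Lam t))"
    by (auto simp: cinst_cinst cvars_abstr s intro!: cinst_cong)
  finally show ?case .
qed auto

lemma phi_not_CStar_lift:
  assumes "\<Gamma> \<turnstile>\<^sub>l lift 0 u : M A"
  shows "phi u \<noteq> U \<star>\<^sub>c V"
  using phi_not_CStar [OF assms, of "cinst (\<lambda>i. CVar (Suc i)) U" "cinst (\<lambda>i. CVar (Suc i)) V"]
  by (auto simp: phi_lift)

lemma abstr_phi_lift:
  assumes "\<And>U V. phi u \<noteq> U \<star>\<^sub>c V"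
  shows "cinst (\<lambda>i. CVar (i - 1)) (abstr 0 (phi (lift 0 u))) = K \<cdot> phi u"
proof -
  have u: "phi (lift 0 u) = cinst (\<lambda>i. CVar (Suc i)) (phi u)"
    by (simp add: phi_lift)
  have "phi (lift 0 u) \<noteq> U \<star>\<^sub>c V" for U V
    unfolding u using assms by (cases "phi u") auto
  moreover have "0 \<notin> cvars (phi (lift 0 u))"
    by (auto simp: u cvars_cinst)
  ultimately show ?thesis
    by (simp add: abstr_fresh u cinst_cinst)
qed


section \<open>Placeholders\<close>

lemma lift_0_lift: "lift (Suc k) (lift 0 t) = lift 0 (lift k t)"
proof -
  have "j \<le> k \<Longrightarrow> lift (Suc k) (lift j t) = lift j (lift k t)" for j
    by (induction t arbitrary: j k) auto
  then show ?thesis by simp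
qed

lemma lsubst_fresh_cong: "occ k t = 0 \<Longrightarrow> lsubst k s t = lsubst k s' t"
  by (induction t arbitrary: k s s') auto

lemma ltyping_fresh_retype:
  assumes "\<Gamma>1 @ T1 # \<Gamma>2 \<turnstile>\<^sub>l t : T" and "occ (length \<Gamma>1) t = 0"
  shows "\<Gamma>1 @ T2 # \<Gamma>2 \<turnstile>\<^sub>l t : T"
  using assms
proof (induction "\<Gamma>1 @ T1 # \<Gamma>2" t T arbitrary: \<Gamma>1 rule: ltyping.induct)
  case (1 i T)
  then show ?case
    by (auto simp: ltyping_LVar_iff nth_append nth_Cons split: nat.splits if_splits)
next
  case (5 A t)
  then have "(M A # \<Gamma>1) @ T2 # \<Gamma>2 \<turnstile>\<^sub>l t : Bot"
    by (metis append_Cons length_Cons occ.simps(2))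
  then show ?case
    by (auto intro: ltyping.intros)
qed (auto intro: ltyping.intros)

text \<open>
  No rule but the one for abstraction has a premise of type \<open>Bot\<close>, so a variable of this type
  which is not the whole term is the body of an abstraction. In \<open>u'\<close> that abstraction is replaced
  by a variable, which takes over the position of the placeholder in the context. It stands for one
  abstraction and thus needs one type only, since the placeholder occurs once.
\<close>

lemma placeholder_is_body:
  assumes "\<Gamma>1 @ Bot # \<Gamma>2 \<turnstile>\<^sub>l u : T"
    and "occ (length \<Gamma>1) u = 1" and "u \<noteq> LVar (length \<Gamma>1)"
  shows "\<exists>u' A. \<Gamma>1 @ M A # \<Gamma>2 \<turnstile>\<^sub>l u' : T \<and> occ (length \<Gamma>1) u' = 1 \<and>
    (\<forall>v. lsubst (length \<Gamma>1) v u = lsubst (length \<Gamma>1) (Lam (lift 0 v)) u')"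
  using assms
proof (induction u arbitrary: \<Gamma>1 T)
  case (LVar i)
  then show ?case by (auto split: if_splits)
next
  case (Lam t)
  then obtain B where B: "T = M (neg B)" "(M B # \<Gamma>1) @ Bot # \<Gamma>2 \<turnstile>\<^sub>l t : Bot"
    by (auto simp: ltyping_Lam_iff)
  show ?case
  proof (cases "t = LVar (Suc (length \<Gamma>1))")
    case True
    have "\<Gamma>1 @ M (neg B) # \<Gamma>2 \<turnstile>\<^sub>l LVar (length \<Gamma>1) : T"
      by (simp add: ltyping_LVar_iff B)
    moreover have "lsubst (length \<Gamma>1) v (Lam t)
        = lsubst (length \<Gamma>1) (Lam (lift 0 v)) (LVar (length \<Gamma>1))" for v
      by (simp add: True)
    ultimately show ?thesis
      by (metis occ.simps(1))
  next
    case False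
    with Lam.IH [OF B(2)] Lam.prems obtain t' A where
      "M B # \<Gamma>1 @ M A # \<Gamma>2 \<turnstile>\<^sub>l t' : Bot" "occ (Suc (length \<Gamma>1)) t' = 1"
      "\<And>v. lsubst (Suc (length \<Gamma>1)) v t = lsubst (Suc (length \<Gamma>1)) (Lam (lift 0 v)) t'"
      by auto
    then show ?thesis
      by (intro exI [of _ "Lam t'"] exI [of _ A]) (auto simp: B lift_0_lift intro: ltyping.intros)
  qed
next
  case (LPair u v)
  then obtain A B where T: "T = M (A \<^bold>\<and> B)"
    and u: "\<Gamma>1 @ Bot # \<Gamma>2 \<turnstile>\<^sub>l u : M A" and v: "\<Gamma>1 @ Bot # \<Gamma>2 \<turnstile>\<^sub>l v : M B"
    by (auto simp: ltyping_LPair_iff)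
  from u v have nu: "u \<noteq> LVar (length \<Gamma>1)" and nv: "v \<noteq> LVar (length \<Gamma>1)"
    by (auto simp: ltyping_LVar_iff)
  \<comment> \<open>The single occurrence is in one component, and the other one is typable with \<open>M D\<close> for \<open>Bot\<close>.\<close>
  from LPair.prems consider "occ (length \<Gamma>1) u = 1" "occ (length \<Gamma>1) v = 0"
    | "occ (length \<Gamma>1) u = 0" "occ (length \<Gamma>1) v = 1"
    by (auto simp: add_is_1)
  then show ?case
  proof cases
    case 1
    with LPair.IH(1) [OF u _ nu] obtain u' D where u': "\<Gamma>1 @ M D # \<Gamma>2 \<turnstile>\<^sub>l u' : M A"
      "occ (length \<Gamma>1) u' = 1"
      "\<And>v. lsubst (length \<Gamma>1) v u = lsubst (length \<Gamma>1) (Lam (lift 0 v)) u'"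
      by auto
    with 1 ltyping_fresh_retype [OF v] show ?thesis
      by (intro exI [of _ "LPair u' v"] exI [of _ D])
        (auto simp: T intro: ltyping.intros lsubst_fresh_cong)
  next
    case 2
    with LPair.IH(2) [OF v _ nv] obtain v' D where v': "\<Gamma>1 @ M D # \<Gamma>2 \<turnstile>\<^sub>l v' : M B"
      "occ (length \<Gamma>1) v' = 1"
      "\<And>w. lsubst (length \<Gamma>1) w v = lsubst (length \<Gamma>1) (Lam (lift 0 w)) v'"
      by auto
    with 2 ltyping_fresh_retype [OF u] show ?thesis
      by (intro exI [of _ "LPair u v'"] exI [of _ D])
        (auto simp: T intro: ltyping.intros lsubst_fresh_cong)
  qed
next
  case (Inj1 t)
  then obtain A B where T: "T = M (A \<^bold>\<or> B)" and t: "\<Gamma>1 @ Bot # \<Gamma>2 \<turnstile>\<^sub>l t : M A"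
    by (auto simp: ltyping_Inj1_iff)
  from t have "t \<noteq> LVar (length \<Gamma>1)"
    by (auto simp: ltyping_LVar_iff)
  with Inj1.IH [OF t] Inj1.prems obtain t' D where "\<Gamma>1 @ M D # \<Gamma>2 \<turnstile>\<^sub>l t' : M A"
    "occ (length \<Gamma>1) t' = 1"
    "\<And>v. lsubst (length \<Gamma>1) v t = lsubst (length \<Gamma>1) (Lam (lift 0 v)) t'"
    by auto
  then show ?case
    by (intro exI [of _ "Inj1 t'"] exI [of _ D]) (auto simp: T intro: ltyping.intros)
next
  case (Inj2 t)
  then obtain A B where T: "T = M (A \<^bold>\<or> B)" and t: "\<Gamma>1 @ Bot # \<Gamma>2 \<turnstile>\<^sub>l t : M B"
    by (auto simp: ltyping_Inj2_iff)
  from t have "t \<noteq> LVar (length \<Gamma>1)"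
    by (auto simp: ltyping_LVar_iff)
  with Inj2.IH [OF t] Inj2.prems obtain t' D where "\<Gamma>1 @ M D # \<Gamma>2 \<turnstile>\<^sub>l t' : M B"
    "occ (length \<Gamma>1) t' = 1"
    "\<And>v. lsubst (length \<Gamma>1) v t = lsubst (length \<Gamma>1) (Lam (lift 0 v)) t'"
    by auto
  then show ?case
    by (intro exI [of _ "Inj2 t'"] exI [of _ D]) (auto simp: T intro: ltyping.intros)
next
  case (LStar u v)
  then obtain A where T: "T = Bot"
    and u: "\<Gamma>1 @ Bot # \<Gamma>2 \<turnstile>\<^sub>l u : M (neg A)" and v: "\<Gamma>1 @ Bot # \<Gamma>2 \<turnstile>\<^sub>l v : M A"
    by (auto simp: ltyping_LStar_iff)
  from u v have nu: "u \<noteq> LVar (length \<Gamma>1)" and nv: "v \<noteq> LVar (length \<Gamma>1)"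
    by (auto simp: ltyping_LVar_iff)
  from LStar.prems consider "occ (length \<Gamma>1) u = 1" "occ (length \<Gamma>1) v = 0"
    | "occ (length \<Gamma>1) u = 0" "occ (length \<Gamma>1) v = 1"
    by (auto simp: add_is_1)
  then show ?case
  proof cases
    case 1
    with LStar.IH(1) [OF u _ nu] obtain u' D where u': "\<Gamma>1 @ M D # \<Gamma>2 \<turnstile>\<^sub>l u' : M (neg A)"
      "occ (length \<Gamma>1) u' = 1"
      "\<And>v. lsubst (length \<Gamma>1) v u = lsubst (length \<Gamma>1) (Lam (lift 0 v)) u'"
      by auto
    with 1 ltyping_fresh_retype [OF v] show ?thesis
      by (intro exI [of _ "u' \<star>\<^sub>l v"] exI [of _ D])
        (auto simp: T intro: ltyping.intros lsubst_fresh_cong)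
  next
    case 2
    with LStar.IH(2) [OF v _ nv] obtain v' D where v': "\<Gamma>1 @ M D # \<Gamma>2 \<turnstile>\<^sub>l v' : M A"
      "occ (length \<Gamma>1) v' = 1"
      "\<And>w. lsubst (length \<Gamma>1) w v = lsubst (length \<Gamma>1) (Lam (lift 0 w)) v'"
      by auto
    with 2 ltyping_fresh_retype [OF u] show ?thesis
      by (intro exI [of _ "u \<star>\<^sub>l v'"] exI [of _ D])
        (auto simp: T intro: ltyping.intros lsubst_fresh_cong)
  qed
qed


section \<open>Simulation\<close>

text \<open>
  The variable of \<open>u'\<close> that replaces the abstraction has index \<open>0\<close>, and \<open>lsubst\<close> moves the other
  variables down, whereas \<open>csubst\<close> leaves them alone. Hence this variable is renamed to
  \<open>length \<Gamma>\<close>, an index which is free after the shift.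
\<close>

lemma phi_triv:
  assumes "Bot # map M \<Gamma> \<turnstile>\<^sub>l u : Bot" and "map M \<Gamma> \<turnstile>\<^sub>l v : Bot"
    and "occ 0 u = 1" and "u \<noteq> LVar 0"
  shows "ccontract (phi (lsubst 0 v u)) (phi v)"
proof -
  obtain u' A where u': "M A # map M \<Gamma> \<turnstile>\<^sub>l u' : Bot" "occ 0 u' = 1"
    "lsubst 0 v u = lsubst 0 (Lam (lift 0 v)) u'"
    using placeholder_is_body [of "[]" "map M \<Gamma>" u Bot] assms by auto
  obtain v1 v2 where v: "v = v1 \<star>\<^sub>l v2"
    using assms(2) by (rule ltyping_BotE)
  have v1: "phi v1 \<noteq> U \<star>\<^sub>c V" and v2: "phi v2 \<noteq> U \<star>\<^sub>c V" for U V
    using assms(2) phi_not_CStar by (auto simp: v ltyping_LStar_iff)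
  have Lam_v: "phi (Lam (lift 0 v)) = C \<cdot> (K \<cdot> phi v1) \<cdot> (K \<cdot> phi v2)"
    unfolding v lift.simps phi_Lam_LStar abstr_phi_lift [OF v1] abstr_phi_lift [OF v2] ..
  have typed: "A # \<Gamma> \<turnstile>\<^sub>c phi u' : Bot"
    using u'(1) ctyping_phi [of "A # \<Gamma>"] by simp
  define W where "W = cinst (\<lambda>i. CVar (if i = 0 then length \<Gamma> else i - 1)) (phi u')"
  have "\<Gamma> @ [A] \<turnstile>\<^sub>c W : Bot"
    unfolding W_def using ctyping_cvars [OF typed]
    by (intro ctyping_cinst [OF typed]) (fastforce simp: ctyping_CVar_iff nth_append nth_Cons')
  moreover have "length \<Gamma> \<in> cvars W"
    using u'(2) by (auto simp: W_def cvars_cinst cvars_phi intro!: bexI [of _ 0])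
  ultimately have "ccontract (csubst (length \<Gamma>) (C \<cdot> (K \<cdot> phi v1) \<cdot> (K \<cdot> phi v2)) W)
      (phi v1 \<star>\<^sub>c phi v2)"
    by (rule ccontract.simp)
  moreover have "phi (lsubst 0 v u) =
      cinst (\<lambda>i. if i = 0 then phi (Lam (lift 0 v)) else CVar (i - 1)) (phi u')"
    unfolding u'(3) by (subst phi_lsubst) (simp_all only: Lam_v, auto)
  then have "phi (lsubst 0 v u) = csubst (length \<Gamma>) (C \<cdot> (K \<cdot> phi v1) \<cdot> (K \<cdot> phi v2)) W"
    unfolding W_def csubst_def cinst_cinst Lam_v
    using ctyping_cvars [OF typed] by (fastforce intro!: cinst_cong)
  ultimately show ?thesis
    by (simp add: v)
qed

lemma abstr_beta:
  assumes "map M (A # \<Gamma>) \<turnstile>\<^sub>l u : Bot" and "\<Delta> \<turnstile>\<^sub>l v : M B"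
  obtains U V where "phi (Lam u) = C \<cdot> U \<cdot> V"
    and "ccompat\<^sup>*\<^sup>* (U \<cdot> phi v \<star>\<^sub>c V \<cdot> phi v) (phi (lsubst 0 v u))"
proof -
  obtain u1 u2 where u: "u = u1 \<star>\<^sub>l u2"
    using assms(1) by (rule ltyping_BotE)
  obtain D where typed: "map M (A # \<Gamma>) \<turnstile>\<^sub>l u1 : M (neg D)" "map M (A # \<Gamma>) \<turnstile>\<^sub>l u2 : M D"
    using assms(1) by (auto simp: u ltyping_LStar_iff)
  let ?pred = "\<lambda>i. CVar (i - 1)"
  have "(\<lambda>i. if i < 0 then CVar i else if i = 0 then phi v else CVar (i - 1)) =
      ?pred(0 := phi v)"
    by auto
  then have subst: "phi (lsubst 0 v t) = cinst (?pred(0 := phi v)) (phi t)" for t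
    using phi_lsubst [of v 0 t] phi_not_CStar [OF assms(2)] by simp
  have "ccompat\<^sup>*\<^sup>* (cinst ?pred (abstr 0 (phi u1)) \<cdot> phi v \<star>\<^sub>c cinst ?pred (abstr 0 (phi u2)) \<cdot> phi v)
      (phi (lsubst 0 v u))"
    unfolding subst u phi.simps cinst.simps
    by (intro ccompat_rtranclp_CStar typed [THEN ctyping_phi, THEN abstr_App_reduces])
  then show thesis
    using that by (simp add: u)
qed

lemma lcontract_simulation:
  assumes "lcontract u v" and "map M \<Gamma> \<turnstile>\<^sub>l u : T"
  shows "ccompat\<^sup>+\<^sup>+ (phi u) (phi v)"
  using assms
proof (induction rule: lcontract.induct)
  case (beta u v)
  then obtain A B where "map M (A # \<Gamma>) \<turnstile>\<^sub>l u : Bot" "map M \<Gamma> \<turnstile>\<^sub>l v : M B"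
    by (auto simp: ltyping_LStar_iff ltyping_Lam_iff)
  then obtain U V where UV: "phi (Lam u) = C \<cdot> U \<cdot> V"
    "ccompat\<^sup>*\<^sup>* (U \<cdot> phi v \<star>\<^sub>c V \<cdot> phi v) (phi (lsubst 0 v u))"
    by (rule abstr_beta)
  have "ccompat (phi (Lam u \<star>\<^sub>l v)) (U \<cdot> phi v \<star>\<^sub>c V \<cdot> phi v)"
    unfolding phi.simps(3) UV(1) by (intro ccompat.intros(1) ccontract.intros)
  then show ?case
    using UV(2) by (rule rtranclp_into_tranclp2)
next
  case (beta_perp v u)
  then obtain A B where "map M (A # \<Gamma>) \<turnstile>\<^sub>l u : Bot" "map M \<Gamma> \<turnstile>\<^sub>l v : M B"
    by (auto simp: ltyping_LStar_iff ltyping_Lam_iff)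
  then obtain U V where UV: "phi (Lam u) = C \<cdot> U \<cdot> V"
    "ccompat\<^sup>*\<^sup>* (U \<cdot> phi v \<star>\<^sub>c V \<cdot> phi v) (phi (lsubst 0 v u))"
    by (rule abstr_beta)
  have "ccompat (phi (v \<star>\<^sub>l Lam u)) (U \<cdot> phi v \<star>\<^sub>c V \<cdot> phi v)"
    unfolding phi.simps(3) UV(1) by (intro ccompat.intros(1) ccontract.intros)
  then show ?case
    using UV(2) by (rule rtranclp_into_tranclp2)
next
  case (eta u)
  then obtain \<Delta> A where "\<Delta> \<turnstile>\<^sub>l lift 0 u : M A"
    by (auto simp: ltyping_LStar_iff ltyping_Lam_iff)
  then have "phi u \<noteq> U \<star>\<^sub>c V" for U V
    by (rule phi_not_CStar_lift)
  then have "phi (Lam (lift 0 u \<star>\<^sub>l LVar 0)) = C \<cdot> (K \<cdot> phi u) \<cdot> I"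
    unfolding phi_Lam_LStar by (subst abstr_phi_lift) simp_all
  then show ?case
    by (simp only:) (intro tranclp.r_into_trancl ccompat.intros(1) ccontract.intros)
next
  case (eta_perp u)
  then obtain \<Delta> A where "\<Delta> \<turnstile>\<^sub>l lift 0 u : M A"
    by (auto simp: ltyping_LStar_iff ltyping_Lam_iff)
  then have "phi u \<noteq> U \<star>\<^sub>c V" for U V
    by (rule phi_not_CStar_lift)
  then have "phi (Lam (LVar 0 \<star>\<^sub>l lift 0 u)) = C \<cdot> I \<cdot> (K \<cdot> phi u)"
    unfolding phi_Lam_LStar by (subst abstr_phi_lift) simp_all
  then show ?case
    by (simp only:) (intro tranclp.r_into_trancl ccompat.intros(1) ccontract.intros)
next
  case (triv \<Delta> u v)
  then show ?case
    by (intro tranclp.r_into_trancl ccompat.intros(1) phi_triv)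
qed (unfold phi.simps, (intro tranclp.r_into_trancl ccompat.intros(1) ccontract.intros)+)

lemma ccompat_tranclp_context:
  assumes "ccompat\<^sup>+\<^sup>+ U V" and "\<And>U V. ccompat U V \<Longrightarrow> ccompat (F U) (F V)"
  shows "ccompat\<^sup>+\<^sup>+ (F U) (F V)"
  using assms by (induction rule: tranclp_induct) (auto intro: tranclp.intros)

lemma lred_omega_simulation:
  "u \<rightarrow>\<^sub>\<omega> v \<Longrightarrow> map M \<Gamma> \<turnstile>\<^sub>l u : T \<Longrightarrow> ccompat\<^sup>+\<^sup>+ (phi u) (phi v)"
proof (induction arbitrary: T rule: lred_omega.induct)
  case (1 u v)
  then show ?case by (rule lcontract_simulation)
next
  case (2 u u' v)
  then have "ccompat\<^sup>+\<^sup>+ (phi u) (phi u')"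
    by (auto simp: ltyping_LPair_iff)
  from ccompat_tranclp_context [OF this, where F = "\<lambda>U. P \<cdot> U \<cdot> phi v"] show ?case
    by (auto intro: ccompat.intros(2-5))
next
  case (3 v v' u)
  then have "ccompat\<^sup>+\<^sup>+ (phi v) (phi v')"
    by (auto simp: ltyping_LPair_iff)
  from ccompat_tranclp_context [OF this, where F = "\<lambda>U. P \<cdot> phi u \<cdot> U"] show ?case
    by (auto intro: ccompat.intros(2-5))
next
  case (4 t t')
  then have "ccompat\<^sup>+\<^sup>+ (phi t) (phi t')"
    by (auto simp: ltyping_Inj1_iff)
  from ccompat_tranclp_context [OF this, where F = "\<lambda>U. Q1 \<cdot> U"] show ?case
    by (auto intro: ccompat.intros(2-5))
next
  case (5 t t')
  then have "ccompat\<^sup>+\<^sup>+ (phi t) (phi t')"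
    by (auto simp: ltyping_Inj2_iff)
  from ccompat_tranclp_context [OF this, where F = "\<lambda>U. Q2 \<cdot> U"] show ?case
    by (auto intro: ccompat.intros(2-5))
next
  case (6 u u' v)
  then have "ccompat\<^sup>+\<^sup>+ (phi u) (phi u')"
    by (auto simp: ltyping_LStar_iff)
  from ccompat_tranclp_context [OF this, where F = "\<lambda>U. U \<star>\<^sub>c phi v"] show ?case
    by (auto intro: ccompat.intros(2-5))
next
  case (7 v v' u)
  then have "ccompat\<^sup>+\<^sup>+ (phi v) (phi v')"
    by (auto simp: ltyping_LStar_iff)
  from ccompat_tranclp_context [OF this, where F = "\<lambda>U. phi u \<star>\<^sub>c U"] show ?case
    by (auto intro: ccompat.intros(2-5))
qed

theorem theorem21:
  fixes u v :: lexp
  assumes "lterm u" and "lterm v" and "u \<rightarrow>\<^sub>\<omega> v"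
  shows "phi u \<triangleright>\<^sup>+ phi v"
proof -
  from \<open>lterm u\<close> obtain \<Gamma> T where "map M \<Gamma> \<turnstile>\<^sub>l u : T"
    by (auto simp: lterm_def)
  then show ?thesis
    using lred_omega_simulation [OF \<open>u \<rightarrow>\<^sub>\<omega> v\<close>] ctyping_phi ccompat_tranclp_imp_cred_tranclp
    by blast
qed

end
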